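(* Let $G$ be a finite group. Then the enhanced power graph $\mathcal{G}_e(G)$ is planar if and only if $\pi_e(G)\subseteq\{1,2,3,4\}$.
   Context: For a group $G$, the enhanced power graph $\mathcal{G}_e(G)$ is the simple undirected graph with vertex set $G$ in which two distinct vertices $x,y$ are adjacent if there exists $z\in G$ with $x=z^m$ and $y=z^n$ for some $m,n\in\mathbb{N}$. $\pi_e(G)=\{o(x):x\in G\}$ is the set of element orders of $G$. *)

theory Defs
  imports "HOL-Analysis.Analysis" "HOL-Algebra.Algebra"
begin

text \<open>A simple undirected graph is a pair of a vertex set and a set of edges, each edge being the
  two-element set of its endpoints.\<close>

type_synonym 'a sgraph = "'a set \<times> 'a set set"

definition enhanced_power_graph :: "('a, 'b) monoid_scheme \<Rightarrow> 'a sgraph" where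
  "enhanced_power_graph G =
    (carrier G,
     {{x, y} | x y. x \<in> carrier G \<and> y \<in> carrier G \<and> x \<noteq> y \<and>
        (\<exists>z\<in>carrier G. \<exists>(m::nat) (n::nat). x = z [^]\<^bsub>G\<^esub> m \<and> y = z [^]\<^bsub>G\<^esub> n)})"

definition element_orders :: "('a, 'b) monoid_scheme \<Rightarrow> nat set" where
  "element_orders G = {group.ord G x | x. x \<in> carrier G}"

text \<open>A drawing without crossings in the plane (the type \<^typ>\<open>complex\<close>): vertices are distinct points,
  every edge is an arc joining its endpoints and passing through no other vertex, and two different
  edges meet at most in common endpoints.\<close>

definition plane_drawing ::
    "'a sgraph \<Rightarrow> ('a \<Rightarrow> complex) \<Rightarrow> ('a set \<Rightarrow> real \<Rightarrow> complex) \<Rightarrow> bool" where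
  "plane_drawing H p \<gamma> \<longleftrightarrow>
    inj_on p (fst H) \<and>
    (\<forall>e\<in>snd H. arc (\<gamma> e) \<and> {pathstart (\<gamma> e), pathfinish (\<gamma> e)} = p ` e \<and>
       path_image (\<gamma> e) \<inter> p ` fst H = p ` e) \<and>
    (\<forall>e\<in>snd H. \<forall>f\<in>snd H. e \<noteq> f \<longrightarrow>
       path_image (\<gamma> e) \<inter> path_image (\<gamma> f) = p ` (e \<inter> f))"

definition planar_graph :: "'a sgraph \<Rightarrow> bool" where
  "planar_graph H \<longleftrightarrow> (\<exists>p \<gamma>. plane_drawing H p \<gamma>)"

end

theory Submission imports Defs begin

text \<open>
  An element of order at least 5 has five distinct powers, which form a complete graph. That graph
  is not planar: of four vertices of a plane complete graph one lies inside the triangle of the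
  other three, and a fifth vertex would then be enclosed by a smaller triangle, separated from a
  vertex to which it is joined.

  If all orders are at most 4, then outside the identity the only edges are those between mutually
  inverse elements and those between an element of order 4 and its square. List every involution
  followed by the pairs \<open>{x, x\<inverse>}\<close> of its square roots, and the elements of order 3 in
  pairs as well. No two edges cross if the vertices are placed in this order along a convex curve
  and joined by chords, and the identity can be joined to all of them from the other side.
\<close>

section \<open>The complete graph on five vertices\<close>

text \<open>\<open>inside K\<close> is a union of components of the complement of \<open>K\<close>,
  and a connected set missing \<open>K\<close> stays within one component.\<close>

lemma subset_inside:
  assumes "connected S" "S \<inter> K = {}" "S \<inter> inside K \<noteq> {}"
  shows "S \<subseteq> inside K"
proof
  fix y assume "y \<in> S"
  obtain x where "x \<in> S" "x \<in> inside K"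
    using assms(3) by blast
  with \<open>y \<in> S\<close> assms(1,2) have "connected_component (- K) x y"
    unfolding connected_component_def by blast
  with \<open>x \<in> inside K\<close> show "y \<in> inside K"
    by (rule inside_same_component[rotated])
qed

lemma connected_component_outside:
  assumes "x \<in> outside S" "y \<in> outside S" "connected (outside S)"
  shows "connected_component (- S) x y"
  unfolding connected_component_def
  using assms outside_no_overlap[of S] by (intro exI[of _ "outside S"]) blast

text \<open>Turns each cycle of a theta graph into a simple closed path, so that the Jordan curve
  theorem applies.\<close>

lemma simple_path_join_reversepath:
  assumes "arc g" "arc h" "pathstart g = a" "pathfinish g = b" "pathstart h = a" "pathfinish h = b"
    "path_image g \<inter> path_image h = {a, b}"
  shows "simple_path (g +++ reversepath h)"
    "pathfinish (g +++ reversepath h) = pathstart (g +++ reversepath h)"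
    "path_image (g +++ reversepath h) = path_image g \<union> path_image h"
proof -
  show "simple_path (g +++ reversepath h)"
    by (rule simple_path_join_loop) (use assms in \<open>simp_all add: arc_reversepath\<close>)
  show "pathfinish (g +++ reversepath h) = pathstart (g +++ reversepath h)"
    using assms(3-6) by simp
  show "path_image (g +++ reversepath h) = path_image g \<union> path_image h"
    using assms(3-6) by (simp add: path_image_join)
qed

text \<open>If none of the three arcs of a theta graph had points inside the closed curve formed by the
  other two, a point inside one of these curves would lie outside the two others. Those two meet in
  a single arc, so by Janiszewski's theorem their union does not separate the point from infinity,
  whereas it contains the first curve.\<close>

lemma theta_chord_inside:
  fixes c c1 c2 :: "real \<Rightarrow> complex"
  assumes arcs: "arc c1" "arc c2" "arc c"
    and ends: "pathstart c1 = a" "pathfinish c1 = b" "pathstart c2 = a" "pathfinish c2 = b"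
      "pathstart c = a" "pathfinish c = b"
    and c1c2: "path_image c1 \<inter> path_image c2 = {a, b}"
    and c1c: "path_image c1 \<inter> path_image c = {a, b}"
    and c2c: "path_image c2 \<inter> path_image c = {a, b}"
    and out1: "path_image c1 \<inter> inside (path_image c2 \<union> path_image c) = {}"
    and out2: "path_image c2 \<inter> inside (path_image c1 \<union> path_image c) = {}"
  shows "path_image c \<inter> inside (path_image c1 \<union> path_image c2) \<noteq> {}"
proof
  assume out: "path_image c \<inter> inside (path_image c1 \<union> path_image c2) = {}"
  let ?A = "path_image c1 \<union> path_image c" and ?B = "path_image c2 \<union> path_image c"
    and ?D = "path_image c1 \<union> path_image c2"
  note sA = simple_path_join_reversepath[OF arcs(1,3) ends(1,2,5,6) c1c]
    and sB = simple_path_join_reversepath[OF arcs(2,3) ends(3,4,5,6) c2c]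
    and sD = simple_path_join_reversepath[OF arcs(1,2) ends(1-4) c1c2]
  note JA = Jordan_inside_outside[OF sA(1,2), unfolded sA(3)]
  note JB = Jordan_inside_outside[OF sB(1,2), unfolded sB(3)]
  note JD = Jordan_inside_outside[OF sD(1,2), unfolded sD(3)]
  have "path_image c - {a, b} \<noteq> {}"
    using nonempty_simple_path_endless[OF arc_imp_simple_path[OF arcs(3)]] by (simp add: ends)
  then have neq: "?A \<noteq> ?D" "?B \<noteq> ?D"
    using c1c c2c by blast+
  obtain x where x: "x \<in> inside ?D"
    using JD by blast
  have "x \<notin> inside ?A"
  proof
    assume xA: "x \<in> inside ?A"
    \<comment> \<open>Each inside misses the other curve and both contain \<open>x\<close>, so they
      coincide. But a closed Jordan curve is the frontier of its inside, and the two curves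
      differ.\<close>
    have "inside ?D \<subseteq> inside ?A"
      by (rule subset_inside) (use JD out x xA inside_no_overlap[of ?D] in blast)+
    moreover have "inside ?A \<subseteq> inside ?D"
      by (rule subset_inside) (use JA out2 x xA inside_no_overlap[of ?A] in blast)+
    ultimately have "inside ?A = inside ?D" by blast
    then show False using JA JD neq by metis
  qed
  moreover have "x \<notin> inside ?B"
  proof
    assume xB: "x \<in> inside ?B"
    have "inside ?D \<subseteq> inside ?B"
      by (rule subset_inside) (use JD out x xB inside_no_overlap[of ?D] in blast)+
    moreover have "inside ?B \<subseteq> inside ?D"
      by (rule subset_inside) (use JB out1 x xB inside_no_overlap[of ?B] in blast)+
    ultimately have "inside ?B = inside ?D" by blast
    then show False using JB JD neq by metis
  qed
  ultimately have x_out: "x \<in> outside ?A" "x \<in> outside ?B"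
    using x out inside_no_overlap[of ?D] inside_Un_outside[of ?A] inside_Un_outside[of ?B] by blast+
  \<comment> \<open>A point \<open>y\<close> outside the whole figure stands for infinity.\<close>
  have "bounded (?A \<union> ?B)"
    using arcs by (simp add: bounded_arc_image)
  then obtain y where y: "y \<in> outside (?A \<union> ?B)"
    using unbounded_outside by fastforce
  have "outside (?A \<union> ?B) \<subseteq> outside ?A" "outside (?A \<union> ?B) \<subseteq> outside ?B"
    "outside (?A \<union> ?B) \<subseteq> outside ?D"
    by (intro outside_mono; blast)+
  with y have y: "y \<in> outside ?A" "y \<in> outside ?B" "y \<in> outside ?D" by blast+
  have "connected_component (- (?A \<union> ?B)) x y"
  proof (rule Janiszewski)
    show "compact ?A" "closed ?B"
      using arcs by (auto simp: compact_arc_image closed_arc_image)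
    have "?A \<inter> ?B = path_image c"
      using c1c2 c1c by blast
    then show "connected (?A \<inter> ?B)"
      using arcs by (simp add: connected_arc_image)
    show "connected_component (- ?A) x y"
      using x_out(1) y(1) by (rule connected_component_outside) (use JA in simp)
    show "connected_component (- ?B) x y"
      using x_out(2) y(2) by (rule connected_component_outside) (use JB in simp)
  qed
  then have "connected_component (- ?D) x y"
    by (rule connected_component_of_subset) blast
  then have "y \<in> inside ?D"
    using x by (rule inside_same_component)
  then show False
    using y JD by blast
qed

text \<open>An edge leaving a corner of a triangle touches the triangle there;
  \<open>subset_inside\<close> can only be applied once that end is removed.\<close>

lemma connected_arc_Diff_start:
  fixes g :: "real \<Rightarrow> 'a::t2_space"
  assumes "arc g"
  shows "connected (path_image g - {pathstart g})"
proof -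
  have "path_image g - {pathstart g} = g ` ({0..1} - {0})"
    unfolding path_image_def pathstart_def
    using assms by (subst inj_on_image_set_diff[where C="{0..1}"]) (auto simp: arc_def)
  also have "{0..1} - {0} = {0<..1::real}"
    by auto
  finally have "path_image g - {pathstart g} = g ` {0<..1}" .
  moreover have "connected (g ` {0<..1})"
  proof (rule connected_continuous_image)
    show "continuous_on {0<..1} g"
      using assms unfolding arc_def path_def by (auto elim: continuous_on_subset)
  qed simp
  ultimately show ?thesis by simp
qed

section \<open>Plane drawings of complete graphs\<close>

text \<open>Arcs are indexed by ordered pairs so that an edge can be traversed from either end; both
  directions trace the same set.\<close>

locale complete_plane_drawing =
  fixes V :: "'a set" and p :: "'a \<Rightarrow> complex" and g :: "'a \<Rightarrow> 'a \<Rightarrow> real \<Rightarrow> complex"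
  assumes inj_p: "inj_on p V"
    and arc_g: "\<lbrakk>x \<in> V; y \<in> V; x \<noteq> y\<rbrakk> \<Longrightarrow> arc (g x y)"
    and start_g: "\<lbrakk>x \<in> V; y \<in> V; x \<noteq> y\<rbrakk> \<Longrightarrow> pathstart (g x y) = p x"
    and finish_g: "\<lbrakk>x \<in> V; y \<in> V; x \<noteq> y\<rbrakk> \<Longrightarrow> pathfinish (g x y) = p y"
    and image_g_commute: "\<lbrakk>x \<in> V; y \<in> V; x \<noteq> y\<rbrakk> \<Longrightarrow> path_image (g x y) = path_image (g y x)"
    and image_g_Int: "\<lbrakk>x \<in> V; y \<in> V; x \<noteq> y; u \<in> V; v \<in> V; u \<noteq> v; {x, y} \<noteq> {u, v}\<rbrakk> \<Longrightarrow>
      path_image (g x y) \<inter> path_image (g u v) = p ` ({x, y} \<inter> {u, v})"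
begin

abbreviation E :: "'a \<Rightarrow> 'a \<Rightarrow> complex set" where
  "E x y \<equiv> path_image (g x y)"

text \<open>The last two sides are bracketed together because \<open>T x y z\<close> is read as the theta graph
  arc \<open>x y\<close> plus the path from \<open>x\<close> to \<open>y\<close> through \<open>z\<close>.\<close>

abbreviation T :: "'a \<Rightarrow> 'a \<Rightarrow> 'a \<Rightarrow> complex set" where
  "T x y z \<equiv> E x y \<union> (E x z \<union> E z y)"

lemma p_in_E: "\<lbrakk>x \<in> V; y \<in> V; x \<noteq> y\<rbrakk> \<Longrightarrow> p x \<in> E x y \<and> p y \<in> E x y"
  by (metis start_g finish_g pathstart_in_path_image pathfinish_in_path_image)

lemma p_eq_iff: "\<lbrakk>x \<in> V; y \<in> V\<rbrakk> \<Longrightarrow> p x = p y \<longleftrightarrow> x = y"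
  using inj_p by (auto simp: inj_on_def)

text \<open>Otherwise \<open>p z\<close> would be common to the edges \<open>x y\<close> and
  \<open>z x\<close>, which meet only in \<open>p x\<close>.\<close>

lemma p_notin_E:
  assumes "x \<in> V" "y \<in> V" "x \<noteq> y" "z \<in> V" "z \<noteq> x" "z \<noteq> y"
  shows "p z \<notin> E x y"
proof
  assume "p z \<in> E x y"
  then have "p z \<in> E x y \<inter> E z x"
    using p_in_E[of z x] assms by auto
  also have "\<dots> = {p x}"
    using image_g_Int[of x y z x] assms by (auto simp: doubleton_eq_iff)
  finally show False using assms by (simp add: p_eq_iff)
qed

lemma E_subset_inside:
  assumes "x \<in> V" "y \<in> V" "x \<noteq> y" "E x y \<inter> K \<subseteq> {p x}" "(E x y - {p x}) \<inter> inside K \<noteq> {}"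
  shows "E x y - {p x} \<subseteq> inside K"
proof (rule subset_inside)
  show "connected (E x y - {p x})"
    using connected_arc_Diff_start[OF arc_g[OF assms(1-3)]] start_g[OF assms(1-3)] by simp
qed (use assms in blast)+

lemma path2:
  assumes "x \<in> V" "y \<in> V" "z \<in> V" "distinct [x, y, z]"
  shows "arc (g x z +++ g z y)" "pathstart (g x z +++ g z y) = p x"
    "pathfinish (g x z +++ g z y) = p y" "path_image (g x z +++ g z y) = E x z \<union> E z y"
proof -
  have ne: "x \<noteq> z" "z \<noteq> y"
    using assms(4) by auto
  note xz = assms(1,3) ne(1) and zy = assms(3,2) ne(2)
  have join: "pathfinish (g x z) = pathstart (g z y)"
    by (simp add: finish_g[OF xz] start_g[OF zy])
  have "E x z \<inter> E z y = {p z}"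
    using assms image_g_Int[OF xz zy] by (auto simp: doubleton_eq_iff)
  then show "arc (g x z +++ g z y)"
    by (intro arc_join arc_g[OF xz] arc_g[OF zy] join) (simp add: start_g[OF zy])
  show "pathstart (g x z +++ g z y) = p x" "pathfinish (g x z +++ g z y) = p y"
    "path_image (g x z +++ g z y) = E x z \<union> E z y"
    by (simp_all add: path_image_join join start_g[OF xz] finish_g[OF zy])
qed

lemma E_disjoint:
  assumes "x \<in> V" "y \<in> V" "u \<in> V" "v \<in> V" "distinct [x, y, u, v]"
  shows "E x y \<inter> E u v = {}"
  using assms image_g_Int[of x y u v] by (auto simp: doubleton_eq_iff)

lemma E_adjacent:
  assumes "x \<in> V" "y \<in> V" "z \<in> V" "distinct [x, y, z]"
  shows "E x y \<inter> E x z = {p x}" "E x y \<inter> E z x = {p x}" "E y x \<inter> E x z = {p x}" "E y x \<inter> E z x = {p x}"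
proof -
  have ne: "x \<noteq> y" "x \<noteq> z" "{x, y} \<noteq> {x, z}" "p ` ({x, y} \<inter> {x, z}) = {p x}"
    using assms(4) by (auto simp: doubleton_eq_iff)
  show "E x y \<inter> E x z = {p x}"
    by (rule trans[OF image_g_Int[OF assms(1,2) ne(1) assms(1,3) ne(2,3)] ne(4)])
  then show "E x y \<inter> E z x = {p x}" "E y x \<inter> E x z = {p x}" "E y x \<inter> E z x = {p x}"
    by (simp_all add: image_g_commute[OF assms(1,2) ne(1)] image_g_commute[OF assms(1,3) ne(2)])
qed

text \<open>The quadrilateral with diagonals \<open>x y\<close> and \<open>u v\<close>, neither of which belongs to it.\<close>

abbreviation Q :: "'a \<Rightarrow> 'a \<Rightarrow> 'a \<Rightarrow> 'a \<Rightarrow> complex set" where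
  "Q x y u v \<equiv> (E x u \<union> E u y) \<union> (E x v \<union> E v y)"

context
  fixes a b c d
  assumes V: "a \<in> V" "b \<in> V" "c \<in> V" "d \<in> V" and dist: "distinct [a, b, c, d]"
begin

lemma neq: "a \<noteq> b" "a \<noteq> c" "a \<noteq> d" "b \<noteq> c" "b \<noteq> d" "c \<noteq> d"
  "b \<noteq> a" "c \<noteq> a" "d \<noteq> a" "c \<noteq> b" "d \<noteq> b" "d \<noteq> c"
  using dist by auto

lemma T_rotate: "T a b c = T c a b"
  using V neq image_g_commute[of a b] image_g_commute[of a c] image_g_commute[of b c] by auto

lemma T_swap: "T a b c = T b a c"
  using V neq image_g_commute[of a b] image_g_commute[of a c] image_g_commute[of b c] by auto

lemma Q_swap: "Q a b c d = Q c d a b"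
  using V neq image_g_commute[of a c] image_g_commute[of a d] image_g_commute[of b c]
    image_g_commute[of b d] by auto

lemma E_T_Int: "E a d \<inter> T a b c \<subseteq> {p a}"
  using E_adjacent(1)[of a d b] E_adjacent(1)[of a d c] E_disjoint[of a d c b] V neq by auto

lemma E_path_Int: "E a b \<inter> (E a c \<union> E c b) = {p a, p b}"
  using E_adjacent(1)[of a b c] E_adjacent(4)[of b a c] V neq by auto

lemma path_path_Int: "(E a c \<union> E c b) \<inter> (E a d \<union> E d b) = {p a, p b}"
  using E_adjacent(1)[of a c d] E_adjacent(4)[of b c d] E_disjoint[of a c d b] E_disjoint[of a d c b]
    V neq by auto

end

section \<open>Insides of triangles and quadrilaterals\<close>

lemma p_notin_inside_T:
  assumes "x \<in> V" "y \<in> V" "z \<in> V" "distinct [x, y, z]"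
  shows "p x \<notin> inside (T x y z)" "p y \<notin> inside (T x y z)" "p z \<notin> inside (T x y z)"
proof -
  have "p x \<in> T x y z" "p y \<in> T x y z" "p z \<in> T x y z"
    using assms p_in_E[of x y] p_in_E[of x z] by auto
  then show "p x \<notin> inside (T x y z)" "p y \<notin> inside (T x y z)" "p z \<notin> inside (T x y z)"
    using inside_no_overlap[of "T x y z"] by blast+
qed

text \<open>The edge meets the triangle at most in its corner \<open>a\<close>, so once inside it
  cannot leave again.\<close>

lemma edge_into_inside:
  assumes V: "a \<in> V" "b \<in> V" "c \<in> V" "d \<in> V" and dist: "distinct [a, b, c, d]"
    and meet: "E a d \<inter> inside (T a b c) \<noteq> {}"
  shows "E a d - {p a} \<subseteq> inside (T a b c)" "p d \<in> inside (T a b c)"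
proof -
  have "p a \<notin> inside (T a b c)"
    using p_notin_inside_T[of a b c] V dist by auto
  then show *: "E a d - {p a} \<subseteq> inside (T a b c)"
    using E_T_Int[OF V dist] meet V dist by (intro E_subset_inside) auto
  have "p d \<in> E a d" "p d \<noteq> p a"
    using p_in_E[of a d] p_eq_iff[of d a] V dist by auto
  with * show "p d \<in> inside (T a b c)"
    by auto
qed

lemma path_outside:
  assumes V: "a \<in> V" "b \<in> V" "c \<in> V" "d \<in> V" and dist: "distinct [a, b, c, d]"
    and out: "p d \<notin> inside (T a b c)"
  shows "(E a d \<union> E d b) \<inter> inside (T a b c) = {}"
proof -
  have "E b d \<inter> inside (T b a c) = {}"
    using edge_into_inside(2)[of b a c d] T_swap[OF V dist] V dist out by auto
  then have "E d b \<inter> inside (T a b c) = {}"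
    using T_swap[OF V dist] image_g_commute[of d b] V dist by auto
  moreover have "E a d \<inter> inside (T a b c) = {}"
    using edge_into_inside(2)[OF V dist] out by blast
  ultimately show ?thesis by blast
qed

text \<open>The edge \<open>d e\<close> shares no vertex with the triangle and hence does not cross
  it.\<close>

lemma inside_neighbour:
  assumes V: "a \<in> V" "b \<in> V" "c \<in> V" "d \<in> V" "e \<in> V" and dist: "distinct [a, b, c, d, e]"
    and d: "p d \<in> inside (T a b c)"
  shows "p e \<in> inside (T a b c)"
proof -
  have de: "d \<noteq> e" using dist by auto
  have "E d e \<subseteq> inside (T a b c)"
  proof (rule subset_inside)
    show "connected (E d e)"
      by (intro connected_arc_image arc_g V de)
    show "E d e \<inter> T a b c = {}"
      using E_disjoint[of d e a b] E_disjoint[of d e a c] E_disjoint[of d e c b] V dist by auto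
    show "E d e \<inter> inside (T a b c) \<noteq> {}"
      using p_in_E[of d e] V de d by blast
  qed
  then show ?thesis
    using p_in_E[of d e] V de by blast
qed

text \<open>A theta graph from \<open>a\<close> to \<open>b\<close>: the path through
  \<open>d\<close> cuts the closed curve formed by the edge \<open>a b\<close> and the path through
  \<open>c\<close>.\<close>

lemma split_by_path:
  assumes V: "a \<in> V" "b \<in> V" "c \<in> V" "d \<in> V" and dist: "distinct [a, b, c, d]"
    and d: "p d \<in> inside (T a b c)"
  shows "inside (T a b d) \<union> inside (Q a b c d) \<union> (E a d \<union> E d b - {p a, p b}) = inside (T a b c)"
proof -
  have V': "a \<in> V" "b \<in> V" "d \<in> V" "c \<in> V" and dist': "distinct [a, b, d, c]"
    using V dist by auto
  have ab: "a \<noteq> b" and dabc: "distinct [a, b, c]" and dabd: "distinct [a, b, d]"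
    using dist by auto
  note e = arc_g[OF V(1,2) ab] start_g[OF V(1,2) ab] finish_g[OF V(1,2) ab]
  note pc = path2[OF V(1,2,3) dabc] and pd = path2[OF V(1,2,4) dabd]
  have pab: "p a \<noteq> p b" using p_eq_iff V ab by auto
  show ?thesis
  proof (rule split_inside_simple_closed_curve[OF arc_imp_simple_path[OF e(1)] e(2,3)
        arc_imp_simple_path[OF pc(1)] pc(2,3) arc_imp_simple_path[OF pd(1)] pd(2,3) pab,
        unfolded pc(4) pd(4)])
    show "E a b \<inter> (E a c \<union> E c b) = {p a, p b}"
      by (rule E_path_Int[OF V dist])
    show "E a b \<inter> (E a d \<union> E d b) = {p a, p b}"
      by (rule E_path_Int[OF V' dist'])
    show "(E a c \<union> E c b) \<inter> (E a d \<union> E d b) = {p a, p b}"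
      by (rule path_path_Int[OF V dist])
    show "(E a d \<union> E d b) \<inter> inside (T a b c) \<noteq> {}"
      using d p_in_E[of a d] V dist by auto
  qed
qed

text \<open>The same theta graph, with the edge \<open>a b\<close> now cutting the quadrilateral
  formed by the two paths.\<close>

lemma split_by_edge:
  assumes V: "a \<in> V" "b \<in> V" "c \<in> V" "d \<in> V" and dist: "distinct [a, b, c, d]"
    and meet: "E a b \<inter> inside (Q a b c d) \<noteq> {}"
  shows "inside (T a b c) \<union> inside (T a b d) \<union> (E a b - {p a, p b}) = inside (Q a b c d)"
proof -
  have V': "a \<in> V" "b \<in> V" "d \<in> V" "c \<in> V" and dist': "distinct [a, b, d, c]"
    using V dist by auto
  have ab: "a \<noteq> b" and dabc: "distinct [a, b, c]" and dabd: "distinct [a, b, d]"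
    using dist by auto
  note e = arc_g[OF V(1,2) ab] start_g[OF V(1,2) ab] finish_g[OF V(1,2) ab]
  note pc = path2[OF V(1,2,3) dabc] and pd = path2[OF V(1,2,4) dabd]
  have pab: "p a \<noteq> p b" using p_eq_iff V ab by auto
  have T: "E a c \<union> E c b \<union> E a b = T a b c" "E a d \<union> E d b \<union> E a b = T a b d"
    by blast+
  show ?thesis
  proof (rule split_inside_simple_closed_curve[OF arc_imp_simple_path[OF pc(1)] pc(2,3)
        arc_imp_simple_path[OF pd(1)] pd(2,3) arc_imp_simple_path[OF e(1)] e(2,3) pab,
        unfolded pc(4) pd(4) T])
    show "(E a c \<union> E c b) \<inter> E a b = {p a, p b}"
      using E_path_Int[OF V dist] by blast
    show "(E a d \<union> E d b) \<inter> E a b = {p a, p b}"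
      using E_path_Int[OF V' dist'] by blast
    show "(E a c \<union> E c b) \<inter> (E a d \<union> E d b) = {p a, p b}"
      by (rule path_path_Int[OF V dist])
    show "E a b \<inter> inside (Q a b c d) \<noteq> {}"
      by (rule meet)
  qed
qed

text \<open>Neither path of the theta graph enters the triangle formed by the other path and
  \<open>a b\<close>, so by \<open>theta_chord_inside\<close> the edge \<open>a b\<close> is the
  chord.\<close>

lemma diagonal_inside:
  assumes V: "a \<in> V" "b \<in> V" "c \<in> V" "d \<in> V" and dist: "distinct [a, b, c, d]"
    and out: "p d \<notin> inside (T a b c)" "p c \<notin> inside (T a b d)"
  shows "E a b \<inter> inside (Q a b c d) \<noteq> {}"
proof -
  have V': "a \<in> V" "b \<in> V" "d \<in> V" "c \<in> V" and dist': "distinct [a, b, d, c]"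
    using V dist by auto
  have ab: "a \<noteq> b" and dabc: "distinct [a, b, c]" and dabd: "distinct [a, b, d]"
    using dist by auto
  note e = arc_g[OF V(1,2) ab] start_g[OF V(1,2) ab] finish_g[OF V(1,2) ab]
  note pc = path2[OF V(1,2,3) dabc] and pd = path2[OF V(1,2,4) dabd]
  have T: "E a c \<union> E c b \<union> E a b = T a b c" "E a d \<union> E d b \<union> E a b = T a b d"
    by blast+
  show ?thesis
  proof (rule theta_chord_inside[OF pc(1) pd(1) e(1) pc(2,3) pd(2,3) e(2,3), unfolded pc(4) pd(4) T])
    show "(E a c \<union> E c b) \<inter> E a b = {p a, p b}"
      using E_path_Int[OF V dist] by blast
    show "(E a d \<union> E d b) \<inter> E a b = {p a, p b}"
      using E_path_Int[OF V' dist'] by blast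
    show "(E a c \<union> E c b) \<inter> (E a d \<union> E d b) = {p a, p b}"
      by (rule path_path_Int[OF V dist])
    show "(E a c \<union> E c b) \<inter> inside (T a b d) = {}"
      by (rule path_outside[OF V' dist' out(2)])
    show "(E a d \<union> E d b) \<inter> inside (T a b c) = {}"
      by (rule path_outside[OF V dist out(1)])
  qed
qed

text \<open>Otherwise both diagonals run inside the quadrilateral \<open>a c b d\<close>, and the diagonal \<open>c d\<close>, lying on
  one side of \<open>a b\<close>, puts \<open>d\<close> inside the triangle \<open>a b c\<close> or \<open>c\<close> inside \<open>a b d\<close>.\<close>

lemma K4_vertex_inside:
  assumes V: "a \<in> V" "b \<in> V" "c \<in> V" "d \<in> V" and dist: "distinct [a, b, c, d]"
  shows "p d \<in> inside (T a b c) \<or> p c \<in> inside (T a b d) \<or>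
    p b \<in> inside (T c d a) \<or> p a \<in> inside (T c d b)"
proof (rule ccontr)
  assume "\<not> ?thesis"
  then have out: "p d \<notin> inside (T a b c)" "p c \<notin> inside (T a b d)"
    "p b \<notin> inside (T c d a)" "p a \<notin> inside (T c d b)"
    by auto
  have V': "c \<in> V" "d \<in> V" "a \<in> V" "b \<in> V" and dist': "distinct [c, d, a, b]"
    using V dist by auto
  have V1: "c \<in> V" "a \<in> V" "b \<in> V" "d \<in> V" and dist1: "distinct [c, a, b, d]"
    and V2: "d \<in> V" "a \<in> V" "b \<in> V" "c \<in> V" and dist2: "distinct [d, a, b, c]"
    and V3: "a \<in> V" "b \<in> V" "d \<in> V" "c \<in> V" and dist3: "distinct [a, b, d, c]"
    using V dist by auto
  \<comment> \<open>Exchanging the pairs \<open>a b\<close> and \<open>c d\<close> leaves the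
    quadrilateral unchanged.\<close>
  have "E c d \<inter> inside (Q a b c d) \<noteq> {}"
    using diagonal_inside[OF V' dist' out(3,4)] Q_swap[OF V dist] by simp
  then obtain q where q: "q \<in> E c d" "q \<in> inside (Q a b c d)" by blast
  have "q \<notin> E a b"
    using E_disjoint[OF V dist] q by blast
  then have "q \<in> inside (T a b c) \<or> q \<in> inside (T a b d)"
    using q split_by_edge[OF V dist diagonal_inside[OF V dist out(1,2)]] by blast
  then show False
  proof
    assume "q \<in> inside (T a b c)"
    then show False
      using edge_into_inside(2)[OF V1 dist1] T_rotate[OF V dist] q(1) out(1) by auto
  next
    assume "q \<in> inside (T a b d)"
    moreover have "q \<in> E d c"
      using q image_g_commute[of c d] V dist by auto
    ultimately show False
      using edge_into_inside(2)[OF V2 dist2] T_rotate[OF V3 dist3] out(2) by auto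
  qed
qed

text \<open>The edges at \<open>d\<close> cut the inside of \<open>a b c\<close> into the insides of three triangles. If \<open>e\<close> lay in one
  of them, so would its neighbour, the vertex of \<open>a b c\<close> that is not on that triangle.\<close>

lemma K5_vertex_not_inside:
  assumes V: "a \<in> V" "b \<in> V" "c \<in> V" "d \<in> V" "e \<in> V" and dist: "distinct [a, b, c, d, e]"
  shows "p d \<notin> inside (T a b c)"
proof
  assume d: "p d \<in> inside (T a b c)"
  have dist4: "distinct [a, b, c, d]" and ne: "c \<noteq> d" "d \<noteq> c"
    using dist by auto
  note nin = p_notin_inside_T[OF V(1,2,3)]
  have e: "p e \<in> inside (T a b c)"
    by (rule inside_neighbour[OF V dist d])
  note split = split_by_path[OF V(1-4) dist4 d]
  have "p e \<notin> E a d" "p e \<notin> E d b" "p e \<notin> E c d"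
    using p_notin_E V dist by auto
  \<comment> \<open>The inside of \<open>T a b d\<close> is part of that of \<open>T a b c\<close>,
    which contains none of its own corners.\<close>
  moreover have c_out: "p c \<notin> inside (T a b d)"
    using split nin dist by auto
  have "p e \<notin> inside (T a b d)"
    using inside_neighbour[of a b d e c] c_out V dist by auto
  ultimately have e': "p e \<in> inside (Q a b c d)" "p e \<notin> E c d"
    using split e by auto
  \<comment> \<open>This licenses cutting the quadrilateral along \<open>c d\<close>. Otherwise a
    point \<open>q\<close> in the middle of that edge would fall inside \<open>T a b d\<close>, and
    the edge, entering from the corner \<open>d\<close>, would bring \<open>c\<close> inside
    too.\<close>
  have "E c d \<inter> inside (Q a b c d) \<noteq> {}"
  proof
    assume empty: "E c d \<inter> inside (Q a b c d) = {}"
    have "E c d - {p c, p d} \<noteq> {}"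
      using nonempty_simple_path_endless[OF arc_imp_simple_path[OF arc_g[OF V(3,4) ne(1)]]]
      by (simp add: start_g[OF V(3,4) ne(1)] finish_g[OF V(3,4) ne(1)])
    then obtain q where q: "q \<in> E c d" "q \<noteq> p c" "q \<noteq> p d" by blast
    have V1: "c \<in> V" "a \<in> V" "b \<in> V" "d \<in> V" and dist1: "distinct [c, a, b, d]"
      and V2: "d \<in> V" "a \<in> V" "b \<in> V" "c \<in> V" and dist2: "distinct [d, a, b, c]"
      and V3: "a \<in> V" "b \<in> V" "d \<in> V" "c \<in> V" and dist3: "distinct [a, b, d, c]"
      using V dist by auto
    have "E c d \<inter> inside (T c a b) \<noteq> {}"
      using d T_rotate[OF V(1-4) dist4] p_in_E[OF V(3,4) ne(1)] by auto
    then have "q \<in> inside (T a b c)"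
      using edge_into_inside(1)[OF V1 dist1] T_rotate[OF V(1-4) dist4] q by auto
    moreover have "q \<notin> E a d" "q \<notin> E d b"
      using E_adjacent(4)[of d c a] E_adjacent(3)[of d c b] q V dist by auto
    ultimately have "q \<in> inside (T a b d)"
      using split empty q by auto
    moreover have "q \<in> E d c"
      using q image_g_commute[of c d] V ne by auto
    ultimately have "p c \<in> inside (T a b d)"
      using edge_into_inside(2)[OF V2 dist2] T_rotate[OF V3 dist3] by auto
    then show False using c_out by simp
  qed
  then have split': "inside (T c d a) \<union> inside (T c d b) \<union> (E c d - {p c, p d}) = inside (Q a b c d)"
    using split_by_edge[of c d a b] Q_swap[OF V(1-4) dist4] V dist by auto
  then have "p e \<in> inside (T c d a) \<or> p e \<in> inside (T c d b)"
    using e' by auto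
  then show False
  proof
    assume "p e \<in> inside (T c d a)"
    then have "p b \<in> inside (T c d a)"
      using inside_neighbour[of c d a e b] V dist by auto
    then show False using split split' nin dist by auto
  next
    assume "p e \<in> inside (T c d b)"
    then have "p a \<in> inside (T c d b)"
      using inside_neighbour[of c d b e a] V dist by auto
    then show False using split split' nin dist by auto
  qed
qed

theorem K5_not_plane:
  assumes V: "a \<in> V" "b \<in> V" "c \<in> V" "d \<in> V" "e \<in> V" and dist: "distinct [a, b, c, d, e]"
  shows False
  using K4_vertex_inside[of a b c d] K5_vertex_not_inside[of a b c d e]
    K5_vertex_not_inside[of a b d c e] K5_vertex_not_inside[of c d a b e]
    K5_vertex_not_inside[of c d b a e] V dist by auto

end

lemma planar_graph_no_K5:
  assumes "planar_graph H" and sub: "{a, b, c, d, e} \<subseteq> fst H" and dist: "distinct [a, b, c, d, e]"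
    and complete: "\<And>x y. x \<in> {a, b, c, d, e} \<Longrightarrow> y \<in> {a, b, c, d, e} \<Longrightarrow> x \<noteq> y \<Longrightarrow> {x, y} \<in> snd H"
  shows False
proof -
  obtain p \<gamma> where "plane_drawing H p \<gamma>"
    using assms(1) unfolding planar_graph_def by blast
  then have inj: "inj_on p (fst H)"
    and edge: "\<And>e. e \<in> snd H \<Longrightarrow> arc (\<gamma> e) \<and> {pathstart (\<gamma> e), pathfinish (\<gamma> e)} = p ` e"
    and Int: "\<And>e f. e \<in> snd H \<Longrightarrow> f \<in> snd H \<Longrightarrow> e \<noteq> f \<Longrightarrow>
      path_image (\<gamma> e) \<inter> path_image (\<gamma> f) = p ` (e \<inter> f)"
    unfolding plane_drawing_def by blast+
  let ?V = "{a, b, c, d, e}"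
  \<comment> \<open>The drawing gives an edge no prescribed direction, so its arc is reversed where
    needed.\<close>
  define g where "g x y = (if pathstart (\<gamma> {x, y}) = p x then \<gamma> {x, y} else reversepath (\<gamma> {x, y}))" for x y
  have image: "path_image (g x y) = path_image (\<gamma> {x, y})" for x y
    by (simp add: g_def)
  interpret complete_plane_drawing ?V p g
  proof
    show "inj_on p ?V"
      using inj sub by (rule inj_on_subset)
    fix x y assume xy: "x \<in> ?V" "y \<in> ?V" "x \<noteq> y"
    have ends: "arc (\<gamma> {x, y})" "{pathstart (\<gamma> {x, y}), pathfinish (\<gamma> {x, y})} = {p x, p y}"
      using edge[OF complete[OF xy]] by auto
    show "arc (g x y)"
      using ends(1) by (simp add: g_def arc_reversepath)
    show "pathstart (g x y) = p x" "pathfinish (g x y) = p y"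
      using ends(2) by (auto simp: g_def doubleton_eq_iff)
    show "path_image (g x y) = path_image (g y x)"
      by (simp add: image insert_commute)
    fix u v assume "u \<in> ?V" "v \<in> ?V" "u \<noteq> v" "{x, y} \<noteq> {u, v}"
    then show "path_image (g x y) \<inter> path_image (g u v) = p ` ({x, y} \<inter> {u, v})"
      unfolding image by (intro Int complete xy)
  qed
  show False
    using dist by (intro K5_not_plane[of a b c d e]) simp_all
qed

section \<open>Drawing with all vertices but one on a parabola\<close>

definition parabola :: "real \<Rightarrow> complex" where
  "parabola t = Complex t (t\<^sup>2)"

text \<open>The signed vertical distance from the parabola, whose sign separates chords from
  spokes.\<close>

definition height :: "complex \<Rightarrow> real" where
  "height z = Im z - (Re z)\<^sup>2"

lemma Re_parabola [simp]: "Re (parabola t) = t"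
  by (simp add: parabola_def)

lemma height_parabola [simp]: "height (parabola t) = 0"
  by (simp add: parabola_def height_def)

lemma parabola_eq_iff [simp]: "parabola s = parabola t \<longleftrightarrow> s = t"
  by (auto simp: parabola_def)

lemma height_eq_0_iff: "height z = 0 \<longleftrightarrow> z = parabola (Re z)"
  by (auto simp: parabola_def height_def complex_eq_iff)

text \<open>The chord lies on the line \<open>y = (a + b) * x - a * b\<close>; subtracting
  \<open>x^2\<close> leaves a quadratic with roots \<open>a\<close> and \<open>b\<close>.\<close>

lemma parabola_chord:
  assumes "z \<in> closed_segment (parabola a) (parabola b)" "a < b"
  shows "a \<le> Re z" "Re z \<le> b" "height z = (Re z - a) * (b - Re z)"
proof -
  obtain s where s: "0 \<le> s" "s \<le> 1" "z = (1 - s) *\<^sub>R parabola a + s *\<^sub>R parabola b"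
    using assms(1) by (auto simp: closed_segment_def)
  then have z: "Re z = a + s * (b - a)" "Im z = a\<^sup>2 + s * (b\<^sup>2 - a\<^sup>2)"
    by (simp_all add: s(3) parabola_def algebra_simps)
  have "s * (b - a) \<le> 1 * (b - a)" "0 \<le> s * (b - a)"
    using s assms(2) by (auto intro: mult_right_mono)
  then show "a \<le> Re z" "Re z \<le> b"
    by (auto simp: z)
  show "height z = (Re z - a) * (b - Re z)"
    unfolding height_def z by (simp add: power2_eq_square algebra_simps)
qed

lemma parabola_spoke:
  assumes "z \<in> closed_segment (Complex 0 (- M)) (parabola a)"
  obtains s where "0 \<le> s" "s \<le> 1" "Re z = s * a" "Im z = s * (a\<^sup>2 + M) - M"
proof -
  obtain s where s: "0 \<le> s" "s \<le> 1" "z = (1 - s) *\<^sub>R Complex 0 (- M) + s *\<^sub>R parabola a"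
    using assms by (auto simp: closed_segment_def)
  show thesis
    by (rule that[of s]) (use s(1,2) in \<open>simp_all add: s(3) parabola_def algebra_simps\<close>)
qed

text \<open>At parameter \<open>s\<close> the height factors as
  \<open>(1 - s) * (s * a^2 - M)\<close>.\<close>

lemma parabola_spoke_below:
  assumes "z \<in> closed_segment (Complex 0 (- M)) (parabola a)" "a\<^sup>2 < M"
  shows "z = parabola a \<or> height z < 0"
proof -
  obtain s where s: "0 \<le> s" "s \<le> 1" "Re z = s * a" "Im z = s * (a\<^sup>2 + M) - M"
    using assms(1) by (rule parabola_spoke)
  show ?thesis
  proof (cases "s = 1")
    case True
    with s show ?thesis by (simp add: parabola_def complex_eq_iff)
  next
    case False
    have "s * a\<^sup>2 \<le> 1 * a\<^sup>2"
      using s by (intro mult_right_mono) auto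
    then have "(1 - s) * (s * a\<^sup>2 - M) < 0"
      using False s assms(2) by (intro mult_pos_neg) auto
    also have "(1 - s) * (s * a\<^sup>2 - M) = height z"
      unfolding height_def s by (simp add: power2_eq_square algebra_simps)
    finally show ?thesis by simp
  qed
qed

text \<open>Away from the apex a common point forces \<open>(a - b) * (a * b - M) = 0\<close>, while
  \<open>2 * a * b \<le> a^2 + b^2 < 2 * M\<close>.\<close>

lemma parabola_spokes_Int:
  assumes "z \<in> closed_segment (Complex 0 (- M)) (parabola a)" "a\<^sup>2 < M"
    and "z \<in> closed_segment (Complex 0 (- M)) (parabola b)" "b\<^sup>2 < M" "a \<noteq> b"
  shows "z = Complex 0 (- M)"
proof -
  obtain s where s: "Re z = s * a" "Im z = s * (a\<^sup>2 + M) - M"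
    using assms(1) by (rule parabola_spoke)
  obtain t where t: "Re z = t * b" "Im z = t * (b\<^sup>2 + M) - M"
    using assms(3) by (rule parabola_spoke)
  have eq: "s * a = t * b" "s * (a\<^sup>2 + M) = t * (b\<^sup>2 + M)"
    using s t by auto
  have "s * (a\<^sup>2 + M) * b = t * b * (b\<^sup>2 + M)"
    unfolding eq(2) by simp
  also have "\<dots> = s * a * (b\<^sup>2 + M)"
    by (simp add: eq(1))
  finally have "s * ((a - b) * (a * b - M)) = 0"
    by (simp add: power2_eq_square algebra_simps)
  moreover have "a * b < M"
    using assms(2,4) sum_squares_bound[of a b] by linarith
  ultimately have "s = 0"
    using \<open>a \<noteq> b\<close> by auto
  with s show ?thesis
    by (simp add: complex_eq_iff)
qed

text \<open>At a common point the two heights agree. For nested intervals their difference is a sum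
  of two nonnegative products, so both vanish, which forces a common end.\<close>

lemma parabola_chords_Int:
  assumes z: "z \<in> closed_segment (parabola a) (parabola b)" "z \<in> closed_segment (parabola c) (parabola d)"
    and "a < b" "c < d" "\<not> (a < c \<and> c < b \<and> b < d)" "\<not> (c < a \<and> a < d \<and> d < b)" "(a, b) \<noteq> (c, d)"
  shows "\<exists>t\<in>{a, b} \<inter> {c, d}. z = parabola t"
proof -
  note ab = parabola_chord[OF z(1) \<open>a < b\<close>] and cd = parabola_chord[OF z(2) \<open>c < d\<close>]
  define x where "x = Re z"
  have x: "a \<le> x" "x \<le> b" "c \<le> x" "x \<le> d" and eq: "(x - a) * (b - x) = (x - c) * (d - x)"
    using ab cd by (auto simp: x_def)
  have nested: "x \<in> {a, b} \<inter> {c, d}"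
    if "a \<le> c" "d \<le> b" "(a, b) \<noteq> (c, d)" "a \<le> x" "x \<le> b" "c \<le> x" "x \<le> d"
      and eq: "(x - a) * (b - x) = (x - c) * (d - x)" for a b c d :: real
  proof -
    have "(x - a) * (b - x) - (x - c) * (d - x) = (c - a) * (b - x) + (x - c) * (b - d)"
      by (simp add: algebra_simps)
    moreover have "0 \<le> (c - a) * (b - x)" "0 \<le> (x - c) * (b - d)"
      using that by auto
    ultimately have "(c - a) * (b - x) = 0" "(x - c) * (b - d) = 0"
      using eq by linarith+
    then show ?thesis using that by auto
  qed
  \<comment> \<open>Without crossing, the intervals are nested or share at most an end.\<close>
  consider "b \<le> c" | "d \<le> a" | "a \<le> c" "d \<le> b" | "c \<le> a" "b \<le> d"
    using assms(5,6) by linarith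
  then have mem: "x \<in> {a, b} \<inter> {c, d}"
  proof cases
    case 3 then show ?thesis using nested[of a c d b] assms(7) x eq by auto
  next
    case 4 then show ?thesis using nested[of c a b d] assms(7) x eq by auto
  qed (use x in auto)
  then have "height z = 0"
    using ab(3) by (auto simp: x_def)
  then show ?thesis
    using mem by (auto simp: height_eq_0_iff x_def)
qed

text \<open>Put the vertex \<open>x \<noteq> v\<close> at \<open>(h x, (h x)\<^sup>2)\<close> on a parabola and \<open>v\<close> so far below that it sees
  all of them: chords run above the parabola and edges at \<open>v\<close> below it.\<close>

lemma planar_graph_apex:
  fixes h :: "'a \<Rightarrow> nat"
  assumes fin: "finite V" and "v \<in> V" and inj: "inj_on h (V - {v})"
    and edges: "\<And>e. e \<in> \<E> \<Longrightarrow> \<exists>x\<in>V. \<exists>y\<in>V. x \<noteq> y \<and> e = {x, y}"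
    and noncrossing: "\<And>x y u w. \<lbrakk>{x, y} \<in> \<E>; {u, w} \<in> \<E>; {x, y, u, w} \<subseteq> V - {v}\<rbrakk>
      \<Longrightarrow> \<not> (h x < h u \<and> h u < h y \<and> h y < h w)"
  shows "planar_graph (V, \<E>)"
proof -
  \<comment> \<open>Large enough to exceed every squared abscissa, as the spoke lemmas
    require.\<close>
  define M :: real where "M = (\<Sum>x\<in>V. (real (h x))\<^sup>2) + 1"
  have M: "(real (h x))\<^sup>2 < M" if "x \<in> V" for x
    using member_le_sum[of x V "\<lambda>x. (real (h x))\<^sup>2"] that fin by (simp add: M_def)
  have "M > 0"
    unfolding M_def by (intro add_nonneg_pos sum_nonneg) auto
  define A where "A = Complex 0 (- M)"
  define p where "p x = (if x = v then A else parabola (h x))" for x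
  have pv: "p v = A" and pW: "\<And>x. x \<noteq> v \<Longrightarrow> p x = parabola (h x)"
    by (auto simp: p_def)
  have height_A: "height A < 0"
    using \<open>M > 0\<close> by (simp add: height_def A_def)
  then have A_neq: "A \<noteq> parabola t" for t
    by (metis height_parabola less_irrefl)
  have h_eq: "h x = h y \<longleftrightarrow> x = y" if "x \<in> V" "x \<noteq> v" "y \<in> V" "y \<noteq> v" for x y
    using inj that by (auto simp: inj_on_def)
  have inj_p: "inj_on p V"
    by (rule inj_onI) (auto simp: p_def A_neq A_neq[symmetric] h_eq split: if_splits)
  have edge_cases: "(\<exists>y\<in>V. y \<noteq> v \<and> e = {v, y}) \<or>
      (\<exists>x\<in>V. \<exists>y\<in>V. x \<noteq> v \<and> y \<noteq> v \<and> h x < h y \<and> e = {x, y})" if e: "e \<in> \<E>" for e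
  proof -
    obtain x y where xy: "x \<in> V" "y \<in> V" "x \<noteq> y" "e = {x, y}"
      using edges[OF e] by blast
    consider "x = v" | "y = v" | "x \<noteq> v" "y \<noteq> v" "h x < h y" | "x \<noteq> v" "y \<noteq> v" "h y < h x"
      using h_eq[of x y] xy by (metis linorder_neqE_nat)
    then show ?thesis
      by cases (use xy in \<open>auto simp: insert_commute\<close>)
  qed
  \<comment> \<open>Edges are straight segments. Writing them as convex hulls makes the image depend
    on the unordered edge only.\<close>
  have "\<exists>g. arc g \<and> {pathstart g, pathfinish g} = p ` e \<and> path_image g = convex hull (p ` e)"
    if e: "e \<in> \<E>" for e
  proof -
    obtain x y where xy: "x \<in> V" "y \<in> V" "x \<noteq> y" "e = {x, y}"
      using edges[OF e] by blast
    then have "p x \<noteq> p y"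
      using inj_p by (auto simp: inj_on_def)
    then show ?thesis
      by (intro exI[of _ "linepath (p x) (p y)"]) (simp add: xy segment_convex_hull)
  qed
  then obtain \<gamma> where \<gamma>: "\<And>e. e \<in> \<E> \<Longrightarrow> arc (\<gamma> e)"
    "\<And>e. e \<in> \<E> \<Longrightarrow> {pathstart (\<gamma> e), pathfinish (\<gamma> e)} = p ` e"
    "\<And>e. e \<in> \<E> \<Longrightarrow> path_image (\<gamma> e) = convex hull (p ` e)"
    by metis
  have spoke: "z \<in> closed_segment (Complex 0 (- M)) (parabola (h y))"
    if "z \<in> convex hull (p ` {v, y})" "y \<noteq> v" for z y
    using that by (simp add: segment_convex_hull pv pW A_def)
  have chord: "z \<in> closed_segment (parabola (h x)) (parabola (h y))"
    if "z \<in> convex hull (p ` {x, y})" "x \<noteq> v" "y \<noteq> v" for z x y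
    using that by (simp add: segment_convex_hull pW)
  have on_chord: "w \<in> {x, y}"
    if "parabola (h w) \<in> convex hull (p ` {x, y})" "x \<in> V" "y \<in> V" "w \<in> V"
      "x \<noteq> v" "y \<noteq> v" "w \<noteq> v" "h x < h y" for w x y
    using parabola_chord(3)[OF chord[OF that(1)]] that by (auto simp: h_eq)
  have chord_above: "height z \<ge> 0"
    if "z \<in> convex hull (p ` {x, y})" "x \<noteq> v" "y \<noteq> v" "h x < h y" for z x y
    using parabola_chord[OF chord[OF that(1-3)]] that(4) by auto
  have vertex: "convex hull (p ` e) \<inter> p ` V = p ` e" if e: "e \<in> \<E>" for e
  proof
    have "e \<subseteq> V"
      using edges[OF e] by blast
    then show "p ` e \<subseteq> convex hull (p ` e) \<inter> p ` V"
      using hull_subset[of "p ` e" convex] by auto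
    have "w \<in> e" if w: "w \<in> V" and mem: "p w \<in> convex hull (p ` e)" for w
      using edge_cases[OF e]
    proof (elim disjE bexE conjE)
      fix y assume y: "y \<in> V" "y \<noteq> v" "e = {v, y}"
      show "w \<in> e"
      proof (cases "w = v")
        case False
        then have "parabola (h w) = parabola (h y)"
          using parabola_spoke_below[OF spoke, of "p w" y] mem y M[OF y(1)] by (auto simp: pW)
        then show ?thesis
          using False w y h_eq[of w y] by simp
      qed (simp add: y)
    next
      fix x y assume xy: "x \<in> V" "y \<in> V" "x \<noteq> v" "y \<noteq> v" "h x < h y" "e = {x, y}"
      have "w \<noteq> v"
        using chord_above[of "p w" x y] mem xy height_A by (auto simp: pv)
      then show "w \<in> e"
        using on_chord[of w x y] mem xy w by (simp add: pW)
    qed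
    then show "convex hull (p ` e) \<inter> p ` V \<subseteq> p ` e"
      by blast
  qed
  \<comment> \<open>A chord has nonnegative height and a spoke negative height except at its upper
    end, so they can meet only there.\<close>
  have spoke_chord: "z \<in> p ` ({v, y} \<inter> {x, u})"
    if z: "z \<in> convex hull (p ` {v, y})" "z \<in> convex hull (p ` {x, u})"
      and "y \<in> V" "x \<in> V" "u \<in> V" "y \<noteq> v" "x \<noteq> v" "u \<noteq> v" "h x < h u" for z y x u
  proof -
    have "height z \<ge> 0"
      using chord_above[OF z(2)] that by blast
    then have zy: "z = parabola (h y)"
      using parabola_spoke_below[OF spoke[OF z(1)] M] that by fastforce
    then have "y \<in> {x, u}"
      using on_chord[of y x u] z(2) that by blast
    then show ?thesis
      using zy \<open>y \<noteq> v\<close> by (intro image_eqI[of _ _ y]) (simp_all add: pW)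
  qed
  have Int: "convex hull (p ` e) \<inter> convex hull (p ` f) = p ` (e \<inter> f)"
    if e: "e \<in> \<E>" and f: "f \<in> \<E>" and "e \<noteq> f" for e f
  proof
    show "p ` (e \<inter> f) \<subseteq> convex hull (p ` e) \<inter> convex hull (p ` f)"
      using hull_subset[of "p ` e" convex] hull_subset[of "p ` f" convex] by auto
    have "z \<in> p ` (e \<inter> f)" if z: "z \<in> convex hull (p ` e)" "z \<in> convex hull (p ` f)" for z
      using edge_cases[OF e] edge_cases[OF f]
    proof (elim disjE bexE conjE)
      fix y u assume yu: "y \<in> V" "y \<noteq> v" "e = {v, y}" "u \<in> V" "u \<noteq> v" "f = {v, u}"
      then have "h y \<noteq> h u"
        using h_eq \<open>e \<noteq> f\<close> by auto
      then have "z = A"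
        unfolding A_def using yu z
        by (intro parabola_spokes_Int[of z M "h y" "h u"] spoke M) auto
      then show ?thesis
        using yu by (intro image_eqI[of _ _ v]) (simp_all add: pv)
    next
      fix y x u assume "y \<in> V" "y \<noteq> v" "e = {v, y}"
        "x \<in> V" "u \<in> V" "x \<noteq> v" "u \<noteq> v" "h x < h u" "f = {x, u}"
      then show ?thesis
        using spoke_chord[of z y x u] z by blast
    next
      fix y x u assume "y \<in> V" "y \<noteq> v" "f = {v, y}"
        "x \<in> V" "u \<in> V" "x \<noteq> v" "u \<noteq> v" "h x < h u" "e = {x, u}"
      then show ?thesis
        using spoke_chord[of z y x u] z by blast
    next
      fix x y u w
      assume xy: "x \<in> V" "y \<in> V" "x \<noteq> v" "y \<noteq> v" "h x < h y" "e = {x, y}"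
        and uw: "u \<in> V" "w \<in> V" "u \<noteq> v" "w \<noteq> v" "h u < h w" "f = {u, w}"
      have "(real (h x), real (h y)) \<noteq> (real (h u), real (h w))"
        using h_eq[of x u] h_eq[of y w] xy uw \<open>e \<noteq> f\<close> by auto
      moreover have "\<not> (h x < h u \<and> h u < h y \<and> h y < h w)" "\<not> (h u < h x \<and> h x < h w \<and> h w < h y)"
        using noncrossing[of x y u w] noncrossing[of u w x y] e f xy uw by auto
      ultimately obtain t where t: "t \<in> {real (h x), real (h y)} \<inter> {real (h u), real (h w)}" "z = parabola t"
        using parabola_chords_Int[of z "h x" "h y" "h u" "h w"] chord[of z x y] chord[of z u w] z xy uw
        by auto
      then obtain q where q: "q \<in> {x, y}" "t = real (h q)" by blast
      then have "q \<in> {u, w}"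
        using t(1) h_eq[of q u] h_eq[of q w] xy uw by auto
      then show ?thesis
        using q t(2) xy uw by (intro image_eqI[of _ _ q]) (auto simp: pW)
    qed
    then show "convex hull (p ` e) \<inter> convex hull (p ` f) \<subseteq> p ` (e \<inter> f)"
      by blast
  qed
  have "plane_drawing (V, \<E>) p \<gamma>"
    unfolding plane_drawing_def using inj_p \<gamma> vertex Int by simp
  then show ?thesis
    unfolding planar_graph_def by blast
qed

section \<open>Enhanced power graphs\<close>

context group
begin

lemma enhanced_power_graph_edges:
  "e \<in> snd (enhanced_power_graph G) \<longleftrightarrow> (\<exists>z\<in>carrier G. \<exists>(m::nat) (n::nat). z [^] m \<noteq> z [^] n \<and> e = {z [^] m, z [^] n})"
  unfolding enhanced_power_graph_def by auto

lemma planar_imp_ord_less_5: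
  assumes "planar_graph (enhanced_power_graph G)" "z \<in> carrier G" "ord z \<noteq> 0"
  shows "ord z < 5"
proof (rule ccontr)
  assume "\<not> ord z < 5"
  \<comment> \<open>Exponents below the order give distinct powers, and powers of one element are
    pairwise adjacent.\<close>
  then have sub: "{0, 1, 2, 3, 4} \<subseteq> {0..ord z - 1}"
    by auto
  define f where "f i = z [^] (i::nat)" for i
  have inj: "inj_on f {0, 1, 2, 3, 4}"
    unfolding f_def by (rule inj_on_subset[OF ord_inj[OF assms(2)] sub])
  show False
  proof (rule planar_graph_no_K5[OF assms(1), of "f 0" "f 1" "f 2" "f 3" "f 4"])
    show "{f 0, f 1, f 2, f 3, f 4} \<subseteq> fst (enhanced_power_graph G)"
      using assms(2) by (simp add: enhanced_power_graph_def f_def)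
    show "distinct [f 0, f 1, f 2, f 3, f 4]"
      using inj by (auto simp: inj_on_def)
    fix x y assume "x \<in> {f 0, f 1, f 2, f 3, f 4}" "y \<in> {f 0, f 1, f 2, f 3, f 4}" "x \<noteq> y"
    then obtain m n where "x = z [^] (m::nat)" "y = z [^] (n::nat)"
      unfolding f_def by blast
    with \<open>x \<noteq> y\<close> show "{x, y} \<in> snd (enhanced_power_graph G)"
      using assms(2) by (auto simp: enhanced_power_graph_edges)
  qed
qed

text \<open>This includes infinite order, where \<open>ord z = 0\<close> and
  \<open>n mod 0 = n\<close>.\<close>

lemma pow_mod_ord: "z \<in> carrier G \<Longrightarrow> z [^] n = z [^] (n mod ord z)" for n :: nat
  by (metis mod_mult_div_eq nat_pow_closed nat_pow_mult nat_pow_one nat_pow_pow pow_ord_eq_1 r_one)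

lemma nontrivial_edge_cases:
  assumes ord: "\<And>z. z \<in> carrier G \<Longrightarrow> ord z \<in> {1, 2, 3, 4}"
    and edge: "{x, y} \<in> snd (enhanced_power_graph G)" and "x \<noteq> \<one>" "y \<noteq> \<one>"
  shows "y = inv x \<or> (ord x = 4 \<and> y = x [^] (2::nat)) \<or> (ord y = 4 \<and> x = y [^] (2::nat))"
proof -
  obtain z m n where z: "z \<in> carrier G" "x = z [^] (m::nat)" "y = z [^] (n::nat)" "x \<noteq> y"
    using edge unfolding enhanced_power_graph_edges by (auto simp: doubleton_eq_iff)
  define i j where "i = m mod ord z" and "j = n mod ord z"
  have ij: "x = z [^] i" "y = z [^] j"
    using z pow_mod_ord[of z m] pow_mod_ord[of z n] by (auto simp: i_def j_def)
  have lt: "i < ord z" "j < ord z"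
    using ord[OF z(1)] by (auto simp: i_def j_def)
  have ne: "i \<noteq> 0" "j \<noteq> 0" "i \<noteq> j"
    using z(1,4) assms(3,4) ij nat_pow_0 by metis+
  have inverse: "y = inv x" if "i + j = ord z"
  proof -
    have "y \<otimes> x = \<one>"
      using z(1) that by (simp add: ij nat_pow_mult add.commute)
    then show ?thesis
      using z by (intro inv_equality[symmetric]) auto
  qed
  have gcd: "gcd 4 (3::nat) = 1"
    by (simp add: gcd_non_0_nat)
  \<comment> \<open>The exponents are distinct, nonzero and below an order of at most 4: they are
    complementary, or the order is 4 and one of them is 2.\<close>
  consider "i + j = ord z" | "ord z = 4" "i = 1" "j = 2" | "ord z = 4" "i = 2" "j = 1"
    | "ord z = 4" "i = 2" "j = 3" | "ord z = 4" "i = 3" "j = 2"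
    using ord[OF z(1)] lt ne by auto linarith+
  then show ?thesis
  proof cases
    case 1 then show ?thesis using inverse by blast
  next
    case 2 then show ?thesis using z(1) by (simp add: ij)
  next
    case 3 then show ?thesis using z(1) by (simp add: ij)
  next
    case 4
    have "ord y = 4"
      using ord_pow_gen[OF z(1), of 3] 4 by (simp add: ij gcd)
    \<comment> \<open>\<open>z^3\<close> is the other generator, and its square \<open>z^6\<close>
      equals \<open>z^2\<close>.\<close>
    moreover have "x = y [^] (2::nat)"
      using pow_mod_ord[OF z(1), of 6] z(1) 4 by (simp add: ij nat_pow_pow)
    ultimately show ?thesis by blast
  next
    case 5
    have "ord x = 4"
      using ord_pow_gen[OF z(1), of 3] 5 by (simp add: ij gcd)
    moreover have "y = x [^] (2::nat)"
      using pow_mod_ord[OF z(1), of 6] z(1) 5 by (simp add: ij nat_pow_pow)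
    ultimately show ?thesis by blast
  qed
qed

lemma ord_le_4_imp_planar:
  assumes fin: "finite (carrier G)" and ord: "\<And>z. z \<in> carrier G \<Longrightarrow> ord z \<in> {1, 2, 3, 4}"
  shows "planar_graph (enhanced_power_graph G)"
proof -
  obtain k :: "'a \<Rightarrow> nat" and n where kn: "k ` carrier G = {i. i < n}" "inj_on k (carrier G)"
    using finite_imp_inj_to_nat_seg[OF fin] by metis
  have k_less: "k x < n" if "x \<in> carrier G" for x
    using kn(1) that by blast
  have k_eq: "k x = k y \<longleftrightarrow> x = y" if "x \<in> carrier G" "y \<in> carrier G" for x y
    using kn(2) that by (auto simp: inj_on_def)
  \<comment> \<open>\<open>h\<close> orders lexicographically by the digits \<open>block\<close>, \<open>slot\<close>, \<open>side\<close>: an involution is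
    followed by its square roots, which come in consecutive pairs of inverse elements, and the
    elements of order 3 form consecutive pairs too.\<close>
  define pair where "pair x = min (k x) (k (inv x))" for x
  define block where "block x = (if ord x = 4 then k (x [^] (2::nat)) else pair x)" for x
  define slot where "slot x = (if ord x = 4 then Suc (pair x) else 0)" for x
  define side :: "'a \<Rightarrow> nat" where "side x = (if k x = pair x then 0 else 1)" for x
  define h where "h x = (block x * Suc n + slot x) * 2 + side x" for x
  \<comment> \<open>Slot 0 is kept for elements not of order 4, such as the involution heading a
    block. The others use slots 1 to \<open>n\<close>, hence the base \<open>Suc n\<close>.\<close>
  have slot_less: "slot x < Suc n" if "x \<in> carrier G" for x
    using k_less[OF that] by (auto simp: slot_def pair_def)
  have h_slot: "h x div 2 mod Suc n = slot x" and h_block: "h x div 2 div Suc n = block x"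
    if "x \<in> carrier G" for x
  proof -
    have "h x div 2 = block x * Suc n + slot x"
      by (simp add: h_def side_def)
    then show "h x div 2 mod Suc n = slot x" "h x div 2 div Suc n = block x"
      using slot_less[OF that] by (simp_all del: mult_Suc_right)
  qed
  have h_side: "h x mod 2 = side x" for x
    unfolding h_def mod_mult_self3 by (simp add: side_def)
  have block_mono: "block x \<le> block y" if "h x \<le> h y" "x \<in> carrier G" "y \<in> carrier G" for x y
    using h_block that by (metis div_le_mono)
  have inj: "inj_on h (carrier G)"
  proof (rule inj_onI)
    fix x y assume xy: "x \<in> carrier G" "y \<in> carrier G" "h x = h y"
    then have eq: "block x = block y" "slot x = slot y" "side x = side y"
      using h_block h_slot h_side by metis+
    \<comment> \<open>The slot reveals whether the order is 4, so \<open>pair\<close> can be read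
      off from the slot or from the block; \<open>side\<close> then tells \<open>x\<close> from its
      inverse.\<close>
    then have "pair x = pair y"
      by (auto simp: block_def slot_def split: if_splits)
    then have "k x = k y \<or> k (inv x) = k (inv y)"
      using eq(3) by (auto simp: side_def pair_def min_def split: if_splits)
    then show "x = y"
      using xy k_eq inv_closed inv_inj by (metis inv_inv)
  qed
  \<comment> \<open>Mutually inverse elements agree in every digit except possibly
    \<open>side\<close>.\<close>
  have inverse: "h (inv x) \<le> Suc (h x)" if x: "x \<in> carrier G" for x
  proof -
    have "inv x [^] (2::nat) = x [^] (2::nat)" if "ord x = 4"
    proof -
      have "x [^] (2::nat) \<otimes> x [^] (2::nat) = \<one>"
        using x that pow_ord_eq_1[OF x] by (simp add: nat_pow_mult)
      then show ?thesis
        using x by (simp add: nat_pow_inv inv_equality)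
    qed
    then have "block (inv x) = block x"
      using x by (simp add: block_def pair_def min.commute)
    moreover have "slot (inv x) = slot x"
      using x by (simp add: slot_def pair_def min.commute)
    ultimately show ?thesis
      by (simp add: h_def side_def)
  qed
  \<comment> \<open>The involution has slot and side 0, so it precedes its square roots in their
    common block.\<close>
  have square: "h (y [^] (2::nat)) \<le> h y" "block (y [^] (2::nat)) = block y" "block y = k (y [^] (2::nat))"
    if y: "y \<in> carrier G" "ord y = 4" for y
  proof -
    let ?t = "y [^] (2::nat)"
    have t: "ord ?t = 2"
      using ord_pow[of y 2] y by simp
    have "?t \<otimes> ?t = \<one>"
      using y pow_ord_eq_1[OF y(1)] by (simp add: nat_pow_mult)
    then have "inv ?t = ?t"
      using y by (simp add: inv_equality)
    then have "pair ?t = k ?t" by (simp add: pair_def)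
    then show block: "block ?t = block y" "block y = k ?t"
      using t y by (simp_all add: block_def)
    show "h ?t \<le> h y"
      using t \<open>pair ?t = k ?t\<close> block by (simp add: h_def slot_def side_def)
  qed
  have edge: "h y = Suc (h x) \<or> ord y = 4 \<and> x = y [^] (2::nat)"
    if xy: "{x, y} \<in> snd (enhanced_power_graph G)" "x \<in> carrier G - {\<one>}" "y \<in> carrier G - {\<one>}" "h x < h y" for x y
    using nontrivial_edge_cases[OF ord xy(1)] xy inverse[of x] square(1)[of x] by auto
  have "planar_graph (carrier G, snd (enhanced_power_graph G))"
  proof (rule planar_graph_apex[where v = \<one> and h = h])
    show "inj_on h (carrier G - {\<one>})"
      using inj by (rule inj_on_subset) blast
    show "\<exists>x\<in>carrier G. \<exists>y\<in>carrier G. x \<noteq> y \<and> e = {x, y}" if "e \<in> snd (enhanced_power_graph G)" for e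
      using that by (auto simp: enhanced_power_graph_def)
    fix x y u w
    assume e: "{x, y} \<in> snd (enhanced_power_graph G)" "{u, w} \<in> snd (enhanced_power_graph G)"
      and sub: "{x, y, u, w} \<subseteq> carrier G - {\<one>}"
    show "\<not> (h x < h u \<and> h u < h y \<and> h y < h w)"
    proof
      \<comment> \<open>Each of the two edges has a vertex strictly between its ends, so neither
        joins consecutive elements; both join an involution to a square root.\<close>
      assume less: "h x < h u \<and> h u < h y \<and> h y < h w"
      then have sq: "ord y = 4" "x = y [^] (2::nat)" "ord w = 4" "u = w [^] (2::nat)"
        using edge[OF e(1)] edge[OF e(2)] sub by auto
      \<comment> \<open>\<open>u\<close> lies between \<open>x\<close> and \<open>y\<close>, which
        share a block, so \<open>u\<close> is in it too; but a block has only one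
        involution.\<close>
      have "block x \<le> block u" "block u \<le> block y"
        using less sub by (auto intro!: block_mono)
      then have "k x = k u"
        using square[of y] square[of w] sq sub by auto
      then show False
        using k_eq[of x u] less sub by auto
    qed
  qed (use fin in auto)
  then show ?thesis
    by (simp add: enhanced_power_graph_def)
qed

end

theorem theorem4p1:
  fixes G :: "('a, 'b) monoid_scheme"
  assumes "group G" and "finite (carrier G)"
  shows "planar_graph (enhanced_power_graph G) \<longleftrightarrow> element_orders G \<subseteq> {1, 2, 3, 4}"
proof -
  interpret group G by (rule assms(1))
  \<comment> \<open>The value 0 of \<open>ord\<close> stands for infinite order, which finiteness
    excludes.\<close>
  have pos: "ord x \<noteq> 0" if "x \<in> carrier G" for x
    using ord_ge_1[OF assms(2) that] by simp
  show ?thesis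
  proof
    assume planar: "planar_graph (enhanced_power_graph G)"
    have "ord x \<in> {1, 2, 3, 4}" if "x \<in> carrier G" for x
      using planar_imp_ord_less_5[OF planar that] pos[OF that] by auto
    then show "element_orders G \<subseteq> {1, 2, 3, 4}"
      unfolding element_orders_def by blast
  next
    assume "element_orders G \<subseteq> {1, 2, 3, 4}"
    then show "planar_graph (enhanced_power_graph G)"
      unfolding element_orders_def by (intro ord_le_4_imp_planar assms(2)) blast
  qed
qed

end
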